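(* Let $G$ be a finite signed (undirected) graph in a closed, connected, oriented surface $S$ of genus $g$, let $\Delta_G\in\Lambda=\mathbb{Z}[x_1^{\pm1},y_1^{\pm1},\ldots,x_g^{\pm1},y_g^{\pm1}]$ denote its Laplacian polynomial with respect to a fixed symplectic basis of $H_1(S;\mathbb{Z})$, and let $\sigma_e\in\{+1,-1\}$ denote the sign of an edge $e$. If $e$ is a non-loop edge of $G$, then $$\Delta_G=\Delta_{G\setminus e}+\sigma_e\,\Delta_{G/e},$$ where $G\setminus e$ is the graph obtained by deleting $e$ and $G/e$ is the graph obtained by contracting $e$.
   Context: Signed graphs: a graph $G$ in $S$ (loops and multiple edges allowed) is signed if each edge $e$ is labeled with a sign $\sigma_e\in\{+1,-1\}$. Connections: fix a symplectic basis $\{x_1,y_1,\ldots,x_g,y_g\}$ of $H_1(S;\mathbb{Z})$, represented by oriented closed curves in $S$ that miss the vertices of $G$ and are transverse to its edges. Write $H_1(S;\mathbb{Z})$ (the deck group of the universal abelian cover of $S$) multiplicatively, so its elements are monomials in the variables $x_i,y_i$ and its group ring is $\Lambda=\mathbb{Z}[x_1^{\pm1},y_1^{\pm1},\ldots,x_g^{\pm1},y_g^{\pm1}]$. A directed path $P$ in $S$ transverse to the basis curves determines a monomial $\phi_P$: travel along $P$ and record $y_k^{\pm1}$ at each crossing with the curve $x_k$ and $x_k^{\pm1}$ at each crossing with the curve $y_k$, the sign of the exponent being given by the direction of crossing, with the sign conventions chosen so that for a closed path $P$ the monomial $\phi_P$ is the homology class of $P$. For a directed edge $e$, $\phi_e$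 is called its connection; reversing the direction inverts $\phi_e$. Laplacian: replace each undirected edge (including loops) by two oppositely directed edges with the same endpoints and the same sign. Let $v_1,\ldots,v_n$ be the vertices. Let $A_G=(a_{i,j})$ be the $n\times n$ matrix with $a_{i,j}=\sum\sigma_e\phi_e$, the sum over all directed edges $e$ from $v_i$ to $v_j$ (for $i=j$, each loop contributes $\sigma_e(\phi_e+\phi_e^{-1})$). Let $\delta_G$ be the diagonal matrix whose $i$-th entry is the sum of the signs $\sigma_e$ of all directed edges leaving $v_i$ (so each loop at $v_i$ counts twice). The Laplacian matrix is $L_G=\delta_G-A_G$, and the Laplacian polynomial is $\Delta_G=\det L_G\in\Lambda$ (independent of the ordering of the vertices). For example, a 1-vertex graph has $\Delta_G=\sum_e\sigma_e(2-\phi_e-\phi_e^{-1})$, the sum over its loops. Contraction: $G/e$ is obtained by shrinking $e$ to a point in $S$, all other edges retaining their signs. Equivalently, if $e$ is directed from $v$ to $w$ ($v\ne w$), delete $e$, remove $w$, and prolong each edge-end at $w$ along $e$ back to $v$. Thus a directed edge $f$ from $u$ to $w$ becomes one from $u$ to $v$ with connection $\phi_f\phi_e^{-1}$, and so on. *)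

theory Defs
  imports
    "HOL-Analysis.Analysis"
    "HOL-Homology.Homology"
    "HOL-Library.Poly_Mapping"
    "Jordan_Normal_Form.Determinant"
begin

section \<open>Closed oriented surfaces\<close>

(* A surface is a subset S of a topological space, with a C^1 atlas of charts (U, h) into the
   plane.  The orientation is carried by the atlas: all coordinate changes have positive Jacobian.
   The differentiable structure is what makes transversality and signs of crossings meaningful. *)

type_synonym 'a chart = "'a set \<times> ('a \<Rightarrow> real ^ 2)"

definition oriented_atlas :: "'a::topological_space set \<Rightarrow> 'a chart set \<Rightarrow> bool" where
  "oriented_atlas S A \<longleftrightarrow>
     (\<Union>(U, h)\<in>A. U) = S \<and>
     (\<forall>(U, h)\<in>A. openin (top_of_set S) U \<and> open (h ` U) \<and>
        homeomorphism U (h ` U) h (inv_into U h)) \<and>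
     (\<forall>(U, h)\<in>A. \<forall>(V, k)\<in>A. \<exists>D :: real ^ 2 \<Rightarrow> real ^ 2 ^ 2.
        continuous_on (h ` (U \<inter> V)) D \<and>
        (\<forall>p \<in> h ` (U \<inter> V).
           ((k \<circ> inv_into U h) has_derivative (\<lambda>v. D p *v v)) (at p) \<and>
           Determinants.det (D p) > 0))"

(* Second countability is automatic for a compact, locally Euclidean space.  The genus is read off
   from the first homology group, which is free abelian of rank 2g. *)

definition closed_oriented_surface ::
    "'a::topological_space set \<Rightarrow> 'a chart set \<Rightarrow> nat \<Rightarrow> bool" where
  "closed_oriented_surface S A g \<longleftrightarrow>
     S \<noteq> {} \<and> compact S \<and> connected S \<and> Hausdorff_space (top_of_set S) \<and>
     oriented_atlas S A \<and>
     homology_group 1 (top_of_set S) \<cong> free_Abelian_group {..<2 * g}"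


section \<open>Closed curves, crossings and symplectic bases\<close>

(* Closed curves are 1-periodic maps defined on the whole real line, so that a derivative makes
   sense at every parameter, including the base point; edges of graphs are paths on [0,1]. *)

definition closed_curve :: "'a::topological_space set \<Rightarrow> (real \<Rightarrow> 'a) \<Rightarrow> bool" where
  "closed_curve S c \<longleftrightarrow> continuous_on UNIV c \<and> range c \<subseteq> S \<and> (\<forall>t. c (t + 1) = c t)"

(* The half-open parameter interval counts the base point of a closed curve once.  For an edge the
   parameter 1 gives a vertex, which the basis curves miss, so nothing is lost there. *)

definition meetings :: "(real \<Rightarrow> 'a) \<Rightarrow> (real \<Rightarrow> 'a) \<Rightarrow> (real \<times> real) set" where
  "meetings p q = {(s, t). s \<in> {0..<1} \<and> t \<in> {0..<1} \<and> p s = q t}"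

(* The meetings at which (p', q') is a frame of orientation \<epsilon> (1 or -1).  The choice of chart is
   irrelevant, since coordinate changes have positive Jacobian. *)

definition crossings ::
    "'a chart set \<Rightarrow> real \<Rightarrow> (real \<Rightarrow> 'a) \<Rightarrow> (real \<Rightarrow> 'a) \<Rightarrow> (real \<times> real) set" where
  "crossings A \<epsilon> p q =
     {(s, t) \<in> meetings p q. \<exists>(U, h)\<in>A. \<exists>u v.
        p s \<in> U \<and>
        ((h \<circ> p) has_vector_derivative u) (at s) \<and>
        ((h \<circ> q) has_vector_derivative v) (at t) \<and>
        sgn (Determinants.det (vector [u, v] :: real ^ 2 ^ 2)) = \<epsilon>}"

(* Finiteness follows from the other clause by compactness: transverse meetings are isolated. *)

definition transverse :: "'a chart set \<Rightarrow> (real \<Rightarrow> 'a) \<Rightarrow> (real \<Rightarrow> 'a) \<Rightarrow> bool" where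
  "transverse A p q \<longleftrightarrow>
     finite (meetings p q) \<and> meetings p q = crossings A 1 p q \<union> crossings A (-1) p q"

definition crossing_number :: "'a chart set \<Rightarrow> (real \<Rightarrow> 'a) \<Rightarrow> (real \<Rightarrow> 'a) \<Rightarrow> int" where
  "crossing_number A p q = int (card (crossings A 1 p q)) - int (card (crossings A (-1) p q))"

(* A point of the standard 1-simplex is a pair (z 0, z 1) with z 0 + z 1 = 1; z 1 runs from 0 at
   the initial vertex to 1 at the final one. *)

definition curve_chain :: "(real \<Rightarrow> 'a) \<Rightarrow> 'a chain" where
  "curve_chain c = frag_of (restrict (\<lambda>z. c (z 1)) (standard_simplex 1))"

definition homologous_curves ::
    "'a::topological_space set \<Rightarrow> (real \<Rightarrow> 'a) \<Rightarrow> (real \<Rightarrow> 'a) \<Rightarrow> bool" where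
  "homologous_curves S c d \<longleftrightarrow> homologous_rel 1 (top_of_set S) {} (curve_chain c) (curve_chain d)"

(* The homology classes of a and b have algebraic intersection number n: the signed count of
   crossings of transverse representatives, which does not depend on the representatives. *)

definition intersection_number_is ::
    "'a::topological_space set \<Rightarrow> 'a chart set \<Rightarrow> (real \<Rightarrow> 'a) \<Rightarrow> (real \<Rightarrow> 'a) \<Rightarrow> int \<Rightarrow> bool"
  where
  "intersection_number_is S A a b n \<longleftrightarrow>
     (\<exists>a' b'. closed_curve S a' \<and> closed_curve S b' \<and>
        homologous_curves S a a' \<and> homologous_curves S b b' \<and>
        transverse A a' b' \<and> crossing_number A a' b' = n)"

definition curve_combination ::
    "nat \<Rightarrow> (nat \<Rightarrow> real \<Rightarrow> 'a) \<Rightarrow> (nat \<Rightarrow> real \<Rightarrow> 'a) \<Rightarrow> (nat \<Rightarrow> int) \<Rightarrow> (nat \<Rightarrow> int) \<Rightarrow> 'a chain" where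
  "curve_combination g x y m n =
     (\<Sum>k<g. frag_cmul (m k) (curve_chain (x k)) + frag_cmul (n k) (curve_chain (y k)))"

(* The curves x k, y k (k < g) represent a symplectic basis of the first integral homology group. *)

definition symplectic_basis ::
    "'a::topological_space set \<Rightarrow> 'a chart set \<Rightarrow> nat \<Rightarrow>
     (nat \<Rightarrow> real \<Rightarrow> 'a) \<Rightarrow> (nat \<Rightarrow> real \<Rightarrow> 'a) \<Rightarrow> bool" where
  "symplectic_basis S A g x y \<longleftrightarrow>
     (\<forall>k<g. closed_curve S (x k) \<and> closed_curve S (y k)) \<and>
     (\<forall>z. singular_relcycle 1 (top_of_set S) {} z \<longrightarrow>
        (\<exists>m n. homologous_rel 1 (top_of_set S) {} z (curve_combination g x y m n))) \<and>
     (\<forall>m n. homologous_rel 1 (top_of_set S) {} (curve_combination g x y m n) 0 \<longrightarrow>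
        (\<forall>k<g. m k = 0 \<and> n k = 0)) \<and>
     (\<forall>i<g. \<forall>j<g.
        intersection_number_is S A (x i) (x j) 0 \<and>
        intersection_number_is S A (y i) (y j) 0 \<and>
        intersection_number_is S A (x i) (y j) (if i = j then 1 else 0))"


section \<open>Laurent polynomials and connections\<close>

(* A monomial is its finitely supported exponent function; addition of exponents is the group of
   monomials, and laurent is its integral group ring.  The ring for genus g is the subring of
   Laurent polynomials in the variables of index less than g. *)

datatype lvar = VarX nat | VarY nat

type_synonym laurent = "(lvar \<Rightarrow>\<^sub>0 int) \<Rightarrow>\<^sub>0 int"

(* If p is closed with class the sum of a_k [x_k] + b_k [y_k], then p . y_k = a_k and
   x_k . p = b_k.  With these signs the monomial of a closed path is its homology class. *)

definition path_exponent ::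
    "'a chart set \<Rightarrow> nat \<Rightarrow> (nat \<Rightarrow> real \<Rightarrow> 'a) \<Rightarrow> (nat \<Rightarrow> real \<Rightarrow> 'a) \<Rightarrow> (real \<Rightarrow> 'a) \<Rightarrow> lvar \<Rightarrow>\<^sub>0 int"
  where
  "path_exponent A g x y p =
     (\<Sum>k<g. Poly_Mapping.single (VarX k) (crossing_number A p (y k)) +
            Poly_Mapping.single (VarY k) (crossing_number A (x k) p))"

definition connection ::
    "'a chart set \<Rightarrow> nat \<Rightarrow> (nat \<Rightarrow> real \<Rightarrow> 'a) \<Rightarrow> (nat \<Rightarrow> real \<Rightarrow> 'a) \<Rightarrow> (real \<Rightarrow> 'a) \<Rightarrow> laurent" where
  "connection A g x y p = Poly_Mapping.single (path_exponent A g x y p) 1"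


section \<open>Signed graphs in a surface\<close>

(* The vertices are listed as v_1, ..., v_n.  An undirected edge e is stored through a
   parametrization arc G e by the unit interval; the choice of direction carries no meaning, and
   (e, True), (e, False) are the two directed edges arising from e. *)

record ('a, 'e) sgraph =
  verts :: "'a list"
  edges :: "'e set"
  arc   :: "'e \<Rightarrow> real \<Rightarrow> 'a"
  esign :: "'e \<Rightarrow> int"

(* Edges are allowed to cross or overlap, so graphs embedded in S are a special case.  This class
   is closed under contraction, where the prolonged edges run parallel to the contracted one. *)

definition signed_graph_in :: "'a::topological_space set \<Rightarrow> ('a, 'e) sgraph \<Rightarrow> bool" where
  "signed_graph_in S G \<longleftrightarrow>
     distinct (verts G) \<and> set (verts G) \<subseteq> S \<and> finite (edges G) \<and>
     (\<forall>e\<in>edges G. path (arc G e) \<and> path_image (arc G e) \<subseteq> S \<and>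
        pathstart (arc G e) \<in> set (verts G) \<and> pathfinish (arc G e) \<in> set (verts G) \<and>
        esign G e \<in> {1, -1})"

definition curves_transverse_to_graph ::
    "'a chart set \<Rightarrow> nat \<Rightarrow> (nat \<Rightarrow> real \<Rightarrow> 'a) \<Rightarrow> (nat \<Rightarrow> real \<Rightarrow> 'a) \<Rightarrow> ('a, 'e) sgraph \<Rightarrow> bool"
  where
  "curves_transverse_to_graph A g x y G \<longleftrightarrow>
     (\<forall>k<g. \<forall>c\<in>{x k, y k}.
        range c \<inter> set (verts G) = {} \<and> (\<forall>e\<in>edges G. transverse A (arc G e) c))"

definition dedges :: "('a, 'e) sgraph \<Rightarrow> ('e \<times> bool) set" where
  "dedges G = edges G \<times> UNIV"

definition darc :: "('a::topological_space, 'e) sgraph \<Rightarrow> 'e \<times> bool \<Rightarrow> real \<Rightarrow> 'a" where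
  "darc G d = (if snd d then arc G (fst d) else reversepath (arc G (fst d)))"

definition is_loop :: "('a::topological_space, 'e) sgraph \<Rightarrow> 'e \<Rightarrow> bool" where
  "is_loop G e \<longleftrightarrow> pathstart (arc G e) = pathfinish (arc G e)"


section \<open>The Laplacian polynomial\<close>

definition adjacency_entry ::
    "'a::topological_space chart set \<Rightarrow> nat \<Rightarrow> (nat \<Rightarrow> real \<Rightarrow> 'a) \<Rightarrow> (nat \<Rightarrow> real \<Rightarrow> 'a) \<Rightarrow>
     ('a, 'e) sgraph \<Rightarrow> 'a \<Rightarrow> 'a \<Rightarrow> laurent" where
  "adjacency_entry A g x y G v w =
     (\<Sum>d\<in>{d \<in> dedges G. pathstart (darc G d) = v \<and> pathfinish (darc G d) = w}.
        of_int (esign G (fst d)) * connection A g x y (darc G d))"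

definition signed_degree :: "('a::topological_space, 'e) sgraph \<Rightarrow> 'a \<Rightarrow> int" where
  "signed_degree G v = (\<Sum>d\<in>{d \<in> dedges G. pathstart (darc G d) = v}. esign G (fst d))"

definition laplacian_matrix ::
    "'a::topological_space chart set \<Rightarrow> nat \<Rightarrow> (nat \<Rightarrow> real \<Rightarrow> 'a) \<Rightarrow> (nat \<Rightarrow> real \<Rightarrow> 'a) \<Rightarrow>
     ('a, 'e) sgraph \<Rightarrow> laurent mat" where
  "laplacian_matrix A g x y G =
     Matrix.mat (length (verts G)) (length (verts G)) (\<lambda>(i, j).
       (if i = j then of_int (signed_degree G (verts G ! i)) else 0)
       - adjacency_entry A g x y G (verts G ! i) (verts G ! j))"

definition laplacian_polynomial ::
    "'a::topological_space chart set \<Rightarrow> nat \<Rightarrow> (nat \<Rightarrow> real \<Rightarrow> 'a) \<Rightarrow> (nat \<Rightarrow> real \<Rightarrow> 'a) \<Rightarrow>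
     ('a, 'e) sgraph \<Rightarrow> laurent" where
  "laplacian_polynomial A g x y G = Determinant.det (laplacian_matrix A g x y G)"


section \<open>Deletion and contraction\<close>

definition delete_edge :: "('a, 'e) sgraph \<Rightarrow> 'e \<Rightarrow> ('a, 'e) sgraph" where
  "delete_edge G e = G\<lparr>edges := edges G - {e}\<rparr>"

(* Ends of p at the final point of r are prolonged along r back to the initial point of r. *)

definition prolong ::
    "(real \<Rightarrow> 'a::topological_space) \<Rightarrow> (real \<Rightarrow> 'a) \<Rightarrow> real \<Rightarrow> 'a" where
  "prolong r p =
     (let q = (if pathfinish p = pathfinish r then p +++ reversepath r else p)
      in if pathstart p = pathfinish r then r +++ q else q)"

(* Contraction of a directed edge d from v to w: the vertex w is removed. *)

definition contract_edge ::
    "('a::topological_space, 'e) sgraph \<Rightarrow> 'e \<times> bool \<Rightarrow> ('a, 'e) sgraph" where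
  "contract_edge G d =
     \<lparr>verts = remove1 (pathfinish (darc G d)) (verts G),
      edges = edges G - {fst d},
      arc = (\<lambda>f. prolong (darc G d) (arc G f)),
      esign = esign G\<rparr>"

end

theory Submission
  imports Defs
begin

text \<open>
  Let \<open>v\<close> and \<open>w\<close> be the ends of the directed edge that is contracted, \<open>\<phi>\<close> its connection and
  \<open>\<sigma>\<close> its sign.  Putting the edge back into the deletion adds to the Laplacian matrix the rank one
  matrix \<open>\<sigma> a b\<close>, where the column \<open>a\<close> is \<open>1\<close> at \<open>v\<close> and \<open>- \<phi>\<inverse>\<close> at \<open>w\<close>, and the row \<open>b\<close> is
  \<open>1\<close> at \<open>v\<close> and \<open>- \<phi>\<close> at \<open>w\<close>.  Add \<open>\<phi>\<close> times row \<open>w\<close> to row \<open>v\<close>, then \<open>\<phi>\<inverse>\<close> times column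
  \<open>w\<close> to column \<open>v\<close>.  This changes no determinant, and it reduces the rank one matrix to the single
  entry \<open>\<sigma>\<close> at position \<open>(w, w)\<close>.  Expanding along row \<open>w\<close> gives the determinant for the deletion
  plus \<open>\<sigma>\<close> times the principal minor of the transformed matrix without row and column \<open>w\<close>
  (\<open>det_rank_one_edge_update\<close>).

  That minor is the Laplacian determinant of the contraction.  An edge end at \<open>w\<close>, once prolonged to
  \<open>v\<close>, acquires a factor \<open>\<phi>\<close> if the edge leaves \<open>w\<close> and \<open>\<phi>\<inverse>\<close> if it enters \<open>w\<close>, which is what
  the row and the column operation do to the entries (\<open>laplacian_entry_contract_edge\<close>).  The signed
  degree of \<open>w\<close> is multiplied by both factors, hence by \<open>1\<close>, and is added to that of \<open>v\<close>.

  The topology enters only through the fact that connections are multiplicative under concatenation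
  of paths and are inverted by reversal.  This is a count of crossings: no crossing lies at an end of
  an edge, and a crossing keeps its sign under an increasing affine reparametrization and changes it
  under a decreasing one.
\<close>

section \<open>Crossings under reparametrization, reversal and concatenation\<close>

text \<open>The condition at a single pair of parameters in the definition of a crossing, isolated
  because it depends only on the germs of the two paths there.\<close>

definition crossing_at ::
    "'a chart set \<Rightarrow> real \<Rightarrow> (real \<Rightarrow> 'a) \<Rightarrow> (real \<Rightarrow> 'a) \<Rightarrow> real \<Rightarrow> real \<Rightarrow> bool" where
  "crossing_at A \<epsilon> p q s t \<longleftrightarrow>
     (\<exists>(U, h)\<in>A. \<exists>u v. p s \<in> U \<and>
        ((h \<circ> p) has_vector_derivative u) (at s) \<and>
        ((h \<circ> q) has_vector_derivative v) (at t) \<and>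
        sgn (Determinants.det (vector [u, v] :: real ^ 2 ^ 2)) = \<epsilon>)"

lemma crossings_iff:
  "(s, t) \<in> crossings A \<epsilon> p q \<longleftrightarrow>
     s \<in> {0..<1} \<and> t \<in> {0..<1} \<and> p s = q t \<and> crossing_at A \<epsilon> p q s t"
  unfolding crossings_def crossing_at_def meetings_def by blast

text \<open>By the chain rule the velocity \<open>u\<close> of \<open>p\<close> becomes \<open>k u\<close>, and the determinant of the frame
  is linear in \<open>u\<close>.\<close>

lemma crossing_at_reparametrized:
  assumes "crossing_at A \<epsilon> p q (k * s + m) t" and "k \<noteq> 0"
    and T: "open T" "s \<in> T" "\<And>r. r \<in> T \<Longrightarrow> p' r = p (k * r + m)"
  shows "crossing_at A (sgn k * \<epsilon>) p' q s t"
proof -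
  obtain U h u v where Uh: "(U, h) \<in> A" and U: "p (k * s + m) \<in> U"
    and u: "((h \<circ> p) has_vector_derivative u) (at (k * s + m))"
    and v: "((h \<circ> q) has_vector_derivative v) (at t)"
    and \<epsilon>: "sgn (Determinants.det (vector [u, v] :: real ^ 2 ^ 2)) = \<epsilon>"
    using assms(1) unfolding crossing_at_def by blast
  have "((\<lambda>r. k * r + m) has_vector_derivative k) (at s)"
    by (auto intro!: derivative_eq_intros simp flip: has_real_derivative_iff_has_vector_derivative)
  then have "(((h \<circ> p) \<circ> (\<lambda>r. k * r + m)) has_vector_derivative k *\<^sub>R u) (at s)"
    using u by (intro vector_diff_chain_at) auto
  then have u': "((h \<circ> p') has_vector_derivative k *\<^sub>R u) (at s)"
    by (rule has_vector_derivative_transform_within_open[OF _ T(1,2)]) (simp add: T(3))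
  have "Determinants.det (vector [k *\<^sub>R u, v] :: real ^ 2 ^ 2) =
      k * Determinants.det (vector [u, v] :: real ^ 2 ^ 2)"
    by (simp add: det_2 algebra_simps)
  then have "sgn (Determinants.det (vector [k *\<^sub>R u, v] :: real ^ 2 ^ 2)) = sgn k * \<epsilon>"
    using \<epsilon> by (simp add: sgn_mult)
  moreover have "p' s \<in> U" using U T by simp
  ultimately show ?thesis unfolding crossing_at_def using Uh u' v by blast
qed

text \<open>An affine map is invertible, so the one-sided statement applies to the inverse map as well.\<close>

lemma crossing_at_affine:
  assumes "k \<noteq> 0" and T: "open T" "s \<in> T" "\<And>r. r \<in> T \<Longrightarrow> p' r = p (k * r + m)"
  shows "crossing_at A (sgn k * \<epsilon>) p' q s t \<longleftrightarrow> crossing_at A \<epsilon> p q (k * s + m) t"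
proof
  assume "crossing_at A \<epsilon> p q (k * s + m) t"
  then show "crossing_at A (sgn k * \<epsilon>) p' q s t"
    using crossing_at_reparametrized assms by blast
next
  assume *: "crossing_at A (sgn k * \<epsilon>) p' q s t"
  let ?g = "\<lambda>z. (1 / k) * z + (- m / k)"
  have inverse: "?g (k * s + m) = s" "\<And>z. k * ?g z + m = z"
    using \<open>k \<noteq> 0\<close> by (auto simp: field_simps)
  have "crossing_at A (sgn (1 / k) * (sgn k * \<epsilon>)) p q (k * s + m) t"
  proof (rule crossing_at_reparametrized[where p = p' and m = "- m / k" and T = "?g -` T"])
    show "crossing_at A (sgn k * \<epsilon>) p' q (1 / k * (k * s + m) + - m / k) t"
      using * inverse(1) by simp
    show "open (?g -` T)"
      using T(1) by (intro open_vimage continuous_intros)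
    show "k * s + m \<in> ?g -` T" using inverse(1) T(2) by simp
    show "p r = p' (1 / k * r + - m / k)" if "r \<in> ?g -` T" for r
      using that inverse(2)[of r] T(3) by simp
  qed (use \<open>k \<noteq> 0\<close> in auto)
  moreover have "sgn (1 / k) * (sgn k * \<epsilon>) = \<epsilon>"
    using \<open>k \<noteq> 0\<close> by (auto simp: sgn_if)
  ultimately show "crossing_at A \<epsilon> p q (k * s + m) t" by (simp only:)
qed

lemma crossing_at_swap:
  assumes "p s = q t" and "crossing_at A \<epsilon> p q s t"
  shows "crossing_at A (- \<epsilon>) q p t s"
proof -
  obtain U h u v where Uh: "(U, h) \<in> A" and U: "p s \<in> U"
    and uv: "((h \<circ> p) has_vector_derivative u) (at s)" "((h \<circ> q) has_vector_derivative v) (at t)"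
    and \<epsilon>: "sgn (Determinants.det (vector [u, v] :: real ^ 2 ^ 2)) = \<epsilon>"
    using assms(2) unfolding crossing_at_def by blast
  have "Determinants.det (vector [v, u] :: real ^ 2 ^ 2) =
      - Determinants.det (vector [u, v] :: real ^ 2 ^ 2)"
    by (simp add: det_2 algebra_simps)
  then have "sgn (Determinants.det (vector [v, u] :: real ^ 2 ^ 2)) = - \<epsilon>"
    by (simp only: sgn_minus \<epsilon>)
  moreover have "q t \<in> U" using U assms(1) by simp
  ultimately show ?thesis unfolding crossing_at_def using Uh uv by blast
qed

lemma crossing_at_swap_iff:
  "p s = q t \<Longrightarrow> crossing_at A (- \<epsilon>) q p t s \<longleftrightarrow> crossing_at A \<epsilon> p q s t"
  using crossing_at_swap[of p s q t A \<epsilon>] crossing_at_swap[of q t p s A "- \<epsilon>"] by auto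

text \<open>Exchanging the two paths exchanges positive and negative crossings.  It allows the exponents
  of both kinds of variables to be treated with the path always in the first place.\<close>

lemma crossing_number_swap: "crossing_number A q p = - crossing_number A p q"
proof -
  have eq: "crossings A (- \<epsilon>) q p = prod.swap ` crossings A \<epsilon> p q" for \<epsilon>
  proof (intro equalityI subsetI)
    fix z assume z: "z \<in> crossings A (- \<epsilon>) q p"
    obtain t s where ts: "z = (t, s)" by force
    then have "(s, t) \<in> crossings A \<epsilon> p q"
      using z crossing_at_swap_iff[of p s q t A \<epsilon>] by (auto simp: crossings_iff)
    then show "z \<in> prod.swap ` crossings A \<epsilon> p q"
      unfolding ts by (intro image_eqI) auto
  next
    fix z assume "z \<in> prod.swap ` crossings A \<epsilon> p q"
    then obtain s t where "(s, t) \<in> crossings A \<epsilon> p q" and "z = (t, s)" by auto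
    then show "z \<in> crossings A (- \<epsilon>) q p"
      using crossing_at_swap_iff[of p s q t A \<epsilon>] by (auto simp: crossings_iff)
  qed
  have "card (crossings A (- \<epsilon>) q p) = card (crossings A \<epsilon> p q)" for \<epsilon>
    unfolding eq by (rule card_image) simp
  from this[of 1] this[of "-1"] show ?thesis
    by (simp add: crossing_number_def)
qed

text \<open>What makes crossing numbers with \<open>c\<close> additive.  The parameter interval of a meeting is half
  open, so a meeting at an end could be lost or moved to another parameter when paths are reversed or
  joined; and only finite sets of crossings have an additive cardinality.\<close>

definition meets_inside :: "(real \<Rightarrow> 'a) \<Rightarrow> (real \<Rightarrow> 'a) \<Rightarrow> bool" where
  "meets_inside c p \<longleftrightarrow> p 0 \<notin> range c \<and> p 1 \<notin> range c \<and> finite (meetings p c)"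

text \<open>The map \<open>s \<mapsto> 1 - s\<close> preserves the open unit interval, in which all crossings lie, and it
  reverses the velocity.\<close>

lemma crossing_number_reversepath:
  assumes "p 0 \<notin> range c" and "p 1 \<notin> range c"
  shows "crossing_number A (reversepath p) c = - crossing_number A p c"
proof -
  let ?f = "\<lambda>(s, t :: real). (1 - s :: real, t)"
  have local: "crossing_at A (- \<epsilon>) (reversepath p) c s t \<longleftrightarrow> crossing_at A \<epsilon> p c (1 - s) t" for \<epsilon> s t
    using crossing_at_affine[of "-1" UNIV s "reversepath p" p 1 A \<epsilon> c t]
    by (simp add: reversepath_def)
  have eq: "crossings A (- \<epsilon>) (reversepath p) c = ?f ` crossings A \<epsilon> p c" for \<epsilon>
  proof (intro equalityI subsetI; clarify)
    fix s t assume "(s, t) \<in> crossings A (- \<epsilon>) (reversepath p) c"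
    then have *: "s \<in> {0..<1}" "t \<in> {0..<1}" "p (1 - s) = c t" "crossing_at A \<epsilon> p c (1 - s) t"
      unfolding crossings_iff local by (auto simp: reversepath_def)
    then have "s \<noteq> 0" using assms(2) by auto
    then have "(1 - s, t) \<in> crossings A \<epsilon> p c" using * by (auto simp: crossings_iff)
    then show "(s, t) \<in> ?f ` crossings A \<epsilon> p c" by force
  next
    fix s t assume *: "(s, t) \<in> crossings A \<epsilon> p c"
    then have "s \<noteq> 0" using assms(1) by (auto simp: crossings_iff)
    then show "(1 - s, t) \<in> crossings A (- \<epsilon>) (reversepath p) c"
      using * unfolding crossings_iff local by (auto simp: reversepath_def)
  qed
  have "card (crossings A (- \<epsilon>) (reversepath p) c) = card (crossings A \<epsilon> p c)" for \<epsilon>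
    unfolding eq by (rule card_image) (auto simp: inj_on_def)
  from this[of 1] this[of "-1"] show ?thesis
    by (simp add: crossing_number_def)
qed

lemma meets_inside_reversepath:
  assumes "meets_inside c p" shows "meets_inside c (reversepath p)"
proof -
  have "meetings (reversepath p) c \<subseteq> (\<lambda>(s, t). (1 - s, t)) ` meetings p c"
  proof clarify
    fix s t assume "(s, t) \<in> meetings (reversepath p) c"
    then have *: "s \<in> {0..<1}" "t \<in> {0..<1}" "p (1 - s) = c t"
      by (auto simp: meetings_def reversepath_def)
    then have "s \<noteq> 0" using assms by (auto simp: meets_inside_def)
    then have "(1 - s, t) \<in> meetings p c" using * by (auto simp: meetings_def)
    then show "(s, t) \<in> (\<lambda>(s, t). (1 - s, t)) ` meetings p c" by force
  qed
  moreover have "finite ((\<lambda>(s, t). (1 - s, t)) ` meetings p c)"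
    using assms by (simp add: meets_inside_def)
  ultimately have "finite (meetings (reversepath p) c)"
    by (rule finite_subset)
  then show ?thesis
    using assms by (simp add: meets_inside_def reversepath_def)
qed

lemma meets_inside_joinpaths:
  assumes "meets_inside c p" and "meets_inside c q"
  shows "meets_inside c (p +++ q)"
proof -
  let ?f = "\<lambda>(s, t :: real). (s / 2 :: real, t)" and ?g = "\<lambda>(s, t :: real). ((s + 1) / 2 :: real, t)"
  have "meetings (p +++ q) c \<subseteq> ?f ` meetings p c \<union> ?g ` meetings q c"
  proof clarify
    fix s t assume "(s, t) \<in> meetings (p +++ q) c" and "(s, t) \<notin> ?g ` meetings q c"
    then have *: "s \<in> {0..<1}" "t \<in> {0..<1}" "(p +++ q) s = c t"
      by (auto simp: meetings_def)
    have "(2 * s - 1, t) \<notin> meetings q c"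
      using \<open>(s, t) \<notin> ?g ` meetings q c\<close> by force
    with * have "s \<le> 1 / 2" by (auto simp: meetings_def joinpaths_def split: if_splits)
    moreover have "s \<noteq> 1 / 2"
    proof
      assume "s = 1 / 2"
      with * have "p 1 = c t" by (simp add: joinpaths_def)
      with assms(1) show False by (simp add: meets_inside_def)
    qed
    ultimately have "(2 * s, t) \<in> meetings p c"
      using * by (auto simp: meetings_def joinpaths_def)
    then show "(s, t) \<in> ?f ` meetings p c" by force
  qed
  moreover have "finite (?f ` meetings p c \<union> ?g ` meetings q c)"
    using assms by (simp add: meets_inside_def)
  ultimately have "finite (meetings (p +++ q) c)"
    by (rule finite_subset)
  then show ?thesis
    using assms by (simp add: meets_inside_def joinpaths_def)
qed

lemma finite_crossings: "meets_inside c p \<Longrightarrow> finite (crossings A \<epsilon> p c)"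
  by (rule finite_subset[of _ "meetings p c"]) (auto simp: meets_inside_def crossings_def)

text \<open>The two halves of the joined path are traversed at double speed, which preserves signs.  At
  the joint, where the path may fail to be differentiable, there is no crossing.\<close>

lemma crossing_number_joinpaths:
  assumes p: "meets_inside c p" and q: "meets_inside c q"
  shows "crossing_number A (p +++ q) c = crossing_number A p c + crossing_number A q c"
proof -
  let ?f = "\<lambda>(s, t :: real). (s / 2 :: real, t)" and ?g = "\<lambda>(s, t :: real). ((s + 1) / 2 :: real, t)"
  have left: "crossing_at A \<epsilon> (p +++ q) c s t \<longleftrightarrow> crossing_at A \<epsilon> p c (2 * s) t"
    if "s < 1 / 2" for \<epsilon> s t
    using crossing_at_affine[of 2 "{..<1/2}" s "p +++ q" p 0 A \<epsilon> c t] that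
    by (simp add: joinpaths_def)
  have right: "crossing_at A \<epsilon> (p +++ q) c s t \<longleftrightarrow> crossing_at A \<epsilon> q c (2 * s - 1) t"
    if "s > 1 / 2" for \<epsilon> s t
    using crossing_at_affine[of 2 "{1/2<..}" s "p +++ q" q "-1" A \<epsilon> c t] that
    by (simp add: joinpaths_def)
  have eq: "crossings A \<epsilon> (p +++ q) c = ?f ` crossings A \<epsilon> p c \<union> ?g ` crossings A \<epsilon> q c" for \<epsilon>
  proof (intro equalityI subsetI)
    fix z assume z: "z \<in> crossings A \<epsilon> (p +++ q) c"
    obtain s t where st: "z = (s, t)" by force
    have *: "s \<in> {0..<1}" "t \<in> {0..<1}" "(p +++ q) s = c t" "crossing_at A \<epsilon> (p +++ q) c s t"
      using z by (auto simp: st crossings_iff)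
    have "s \<noteq> 1 / 2"
    proof
      assume "s = 1 / 2"
      with * have "p 1 = c t" by (simp add: joinpaths_def)
      with p show False by (simp add: meets_inside_def)
    qed
    then consider "s < 1 / 2" | "s > 1 / 2" by linarith
    then show "z \<in> ?f ` crossings A \<epsilon> p c \<union> ?g ` crossings A \<epsilon> q c"
    proof cases
      case 1
      have "p (2 * s) = c t" using * 1 by (simp add: joinpaths_def)
      moreover have "crossing_at A \<epsilon> p c (2 * s) t" using * 1 left by blast
      ultimately have "(2 * s, t) \<in> crossings A \<epsilon> p c"
        using * 1 by (simp add: crossings_iff)
      then show ?thesis unfolding st by force
    next
      case 2
      have "q (2 * s - 1) = c t" using * 2 by (simp add: joinpaths_def)
      moreover have "crossing_at A \<epsilon> q c (2 * s - 1) t" using * 2 right by blast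
      ultimately have "(2 * s - 1, t) \<in> crossings A \<epsilon> q c"
        using * 2 by (simp add: crossings_iff)
      then show ?thesis unfolding st by force
    qed
  next
    fix z assume "z \<in> ?f ` crossings A \<epsilon> p c \<union> ?g ` crossings A \<epsilon> q c"
    then consider s t where "z = (s / 2, t)" "(s, t) \<in> crossings A \<epsilon> p c"
      | s t where "z = ((s + 1) / 2, t)" "(s, t) \<in> crossings A \<epsilon> q c" by auto
    then show "z \<in> crossings A \<epsilon> (p +++ q) c"
    proof cases
      case (1 s t)
      then have "s / 2 < 1 / 2" "(p +++ q) (s / 2) = c t"
        by (auto simp: crossings_iff joinpaths_def)
      then show ?thesis using 1 left[of "s / 2" \<epsilon> t] by (simp add: crossings_iff)
    next
      case (2 s t)
      \<comment> \<open>The joint is excluded, so near this parameter the joined path is a piece of \<open>q\<close> alone.\<close>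
      then have "s \<noteq> 0" using q by (auto simp: crossings_iff meets_inside_def)
      then have "0 < s" using 2(2) by (auto simp: crossings_iff)
      have half: "2 * ((s + 1) / 2) - 1 = s" by (simp add: field_simps)
      have "(s + 1) / 2 > 1 / 2" "(p +++ q) ((s + 1) / 2) = c t"
        using 2 \<open>0 < s\<close> half by (auto simp: crossings_iff joinpaths_def)
      then show ?thesis using 2 right[of "(s + 1) / 2" \<epsilon> t]
        unfolding half by (simp add: crossings_iff)
    qed
  qed
  have "card (crossings A \<epsilon> (p +++ q) c) = card (crossings A \<epsilon> p c) + card (crossings A \<epsilon> q c)" for \<epsilon>
  proof -
    have "card (crossings A \<epsilon> (p +++ q) c) =
        card (?f ` crossings A \<epsilon> p c) + card (?g ` crossings A \<epsilon> q c)"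
      unfolding eq using p q
      by (intro card_Un_disjoint) (auto simp: finite_crossings crossings_iff)
    also have "card (?f ` crossings A \<epsilon> p c) = card (crossings A \<epsilon> p c)"
      by (rule card_image) (auto simp: inj_on_def)
    also have "card (?g ` crossings A \<epsilon> q c) = card (crossings A \<epsilon> q c)"
      by (rule card_image) (auto simp: inj_on_def)
    finally show ?thesis .
  qed
  then show ?thesis by (simp add: crossing_number_def)
qed

section \<open>Connections of reversed and concatenated paths\<close>

definition meets_basis_inside ::
    "nat \<Rightarrow> (nat \<Rightarrow> real \<Rightarrow> 'a) \<Rightarrow> (nat \<Rightarrow> real \<Rightarrow> 'a) \<Rightarrow> (real \<Rightarrow> 'a) \<Rightarrow> bool" where
  "meets_basis_inside g x y p \<longleftrightarrow> (\<forall>k<g. meets_inside (x k) p \<and> meets_inside (y k) p)"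

lemma path_exponent_eq:
  "path_exponent A g x y p =
     (\<Sum>k<g. Poly_Mapping.single (VarX k) (crossing_number A p (y k))
           - Poly_Mapping.single (VarY k) (crossing_number A p (x k)))"
proof -
  have "crossing_number A (x k) p = - crossing_number A p (x k)" for k
    by (rule crossing_number_swap)
  then show ?thesis
    by (simp only: path_exponent_def single_uminus add_uminus_conv_diff)
qed

lemma path_exponent_reversepath:
  assumes "meets_basis_inside g x y p"
  shows "path_exponent A g x y (reversepath p) = - path_exponent A g x y p"
proof -
  have "path_exponent A g x y (reversepath p) =
      (\<Sum>k<g. - (Poly_Mapping.single (VarX k) (crossing_number A p (y k))
             - Poly_Mapping.single (VarY k) (crossing_number A p (x k))))"
    unfolding path_exponent_eq
  proof (rule sum.cong[OF refl])
    fix k assume "k \<in> {..<g}"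
    then have neg: "crossing_number A (reversepath p) (x k) = - crossing_number A p (x k)"
      "crossing_number A (reversepath p) (y k) = - crossing_number A p (y k)"
      using assms by (simp_all add: meets_basis_inside_def meets_inside_def crossing_number_reversepath)
    show "Poly_Mapping.single (VarX k) (crossing_number A (reversepath p) (y k))
        - Poly_Mapping.single (VarY k) (crossing_number A (reversepath p) (x k)) =
      - (Poly_Mapping.single (VarX k) (crossing_number A p (y k))
        - Poly_Mapping.single (VarY k) (crossing_number A p (x k)))"
      by (simp only: neg single_uminus minus_diff_minus)
  qed
  then show ?thesis by (simp only: sum_negf path_exponent_eq[of A g x y p])
qed

lemma path_exponent_joinpaths:
  assumes "meets_basis_inside g x y p" and "meets_basis_inside g x y q"
  shows "path_exponent A g x y (p +++ q) = path_exponent A g x y p + path_exponent A g x y q"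
proof -
  have "path_exponent A g x y (p +++ q) =
      (\<Sum>k<g. (Poly_Mapping.single (VarX k) (crossing_number A p (y k))
             - Poly_Mapping.single (VarY k) (crossing_number A p (x k)))
           + (Poly_Mapping.single (VarX k) (crossing_number A q (y k))
             - Poly_Mapping.single (VarY k) (crossing_number A q (x k))))"
    unfolding path_exponent_eq
  proof (rule sum.cong[OF refl])
    fix k assume "k \<in> {..<g}"
    then have add: "crossing_number A (p +++ q) (x k) = crossing_number A p (x k) + crossing_number A q (x k)"
      "crossing_number A (p +++ q) (y k) = crossing_number A p (y k) + crossing_number A q (y k)"
      using assms by (simp_all add: meets_basis_inside_def crossing_number_joinpaths)
    show "Poly_Mapping.single (VarX k) (crossing_number A (p +++ q) (y k))
        - Poly_Mapping.single (VarY k) (crossing_number A (p +++ q) (x k)) =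
      (Poly_Mapping.single (VarX k) (crossing_number A p (y k))
        - Poly_Mapping.single (VarY k) (crossing_number A p (x k)))
      + (Poly_Mapping.single (VarX k) (crossing_number A q (y k))
        - Poly_Mapping.single (VarY k) (crossing_number A q (x k)))"
      by (simp only: add single_add add_diff_add)
  qed
  then show ?thesis
    by (simp only: sum.distrib path_exponent_eq[of A g x y p] path_exponent_eq[of A g x y q])
qed

lemma meets_basis_inside_reversepath: "meets_basis_inside g x y p \<Longrightarrow> meets_basis_inside g x y (reversepath p)"
  by (simp add: meets_basis_inside_def meets_inside_reversepath)

lemma meets_basis_inside_joinpaths:
  "meets_basis_inside g x y p \<Longrightarrow> meets_basis_inside g x y q \<Longrightarrow> meets_basis_inside g x y (p +++ q)"
  by (simp add: meets_basis_inside_def meets_inside_joinpaths)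

lemma connection_reversepath_inverse:
  assumes "meets_basis_inside g x y p"
  shows "connection A g x y p * connection A g x y (reversepath p) = 1"
  by (simp only: connection_def path_exponent_reversepath[OF assms] mult_single
      add.right_inverse mult_1 single_one)

text \<open>Prolonging an initial end along \<open>r\<close> adds the exponent of \<open>r\<close>, prolonging a final end adds that
  of the reversed path.  For a loop at the final point of \<open>r\<close> both happen and cancel.\<close>

lemma prolong_ends_and_exponent:
  assumes r: "meets_basis_inside g x y r" and p: "meets_basis_inside g x y p"
  shows "meets_basis_inside g x y (prolong r p)"
    and "pathstart (prolong r p) =
           (if pathstart p = pathfinish r then pathstart r else pathstart p)"
    and "pathfinish (prolong r p) =
           (if pathfinish p = pathfinish r then pathstart r else pathfinish p)"
    and "path_exponent A g x y (prolong r p) =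
           (if pathstart p = pathfinish r then path_exponent A g x y r else 0)
           + path_exponent A g x y p
           - (if pathfinish p = pathfinish r then path_exponent A g x y r else 0)"
proof -
  define q where "q = (if pathfinish p = pathfinish r then p +++ reversepath r else p)"
  have eq: "prolong r p = (if pathstart p = pathfinish r then r +++ q else q)"
    by (simp only: prolong_def Let_def q_def[symmetric])
  have q: "meets_basis_inside g x y q" "pathstart q = pathstart p"
    "pathfinish q = (if pathfinish p = pathfinish r then pathstart r else pathfinish p)"
    using r p by (simp_all add: q_def meets_basis_inside_joinpaths meets_basis_inside_reversepath)
  have exp: "path_exponent A g x y q = path_exponent A g x y p
      - (if pathfinish p = pathfinish r then path_exponent A g x y r else 0)"
    by (simp add: q_def r p meets_basis_inside_reversepath path_exponent_joinpaths path_exponent_reversepath)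
  show "meets_basis_inside g x y (prolong r p)"
    by (simp add: eq r q(1) meets_basis_inside_joinpaths)
  show "pathstart (prolong r p) =
      (if pathstart p = pathfinish r then pathstart r else pathstart p)"
    by (simp add: eq q(2))
  show "pathfinish (prolong r p) =
      (if pathfinish p = pathfinish r then pathstart r else pathfinish p)"
    by (simp add: eq q(3))
  show "path_exponent A g x y (prolong r p) =
      (if pathstart p = pathfinish r then path_exponent A g x y r else 0)
      + path_exponent A g x y p
      - (if pathfinish p = pathfinish r then path_exponent A g x y r else 0)"
    by (cases "pathstart p = pathfinish r")
      (simp_all only: eq exp path_exponent_joinpaths[OF r q(1)] if_True if_False
        add_diff_eq add_0_left simp_thms)
qed

section \<open>A determinant identity\<close>

text \<open>In the expansion along row \<open>k\<close> the cofactors do not see the altered entry.\<close>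

lemma det_add_diagonal_entry:
  fixes X Y :: "'a::comm_ring_1 mat"
  assumes X: "X \<in> carrier_mat n n" and Y: "Y \<in> carrier_mat n n" and k: "k < n"
    and YX: "\<And>i j. i < n \<Longrightarrow> j < n \<Longrightarrow> Y $$ (i, j) = X $$ (i, j) + (if i = k \<and> j = k then s else 0)"
  shows "Determinant.det Y = Determinant.det X + s * Determinant.det (mat_delete X k k)"
proof -
  have del: "mat_delete Y k j = mat_delete X k j" for j
    using X Y by (intro eq_matI) (auto simp: mat_delete_def YX)
  have "Determinant.det Y = (\<Sum>j<n. Y $$ (k, j) * cofactor Y k j)"
    by (rule laplace_expansion_row[OF Y k])
  also have "\<dots> = (\<Sum>j<n. X $$ (k, j) * cofactor X k j + (if j = k then s * cofactor X k k else 0))"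
    using k by (intro sum.cong refl) (auto simp: YX cofactor_def del algebra_simps)
  also have "\<dots> = Determinant.det X + s * cofactor X k k"
    using k by (simp add: sum.distrib laplace_expansion_row[OF X k])
  also have "cofactor X k k = Determinant.det (mat_delete X k k)"
    by (simp add: cofactor_def)
  finally show ?thesis .
qed

text \<open>Since \<open>a * b = 1\<close>, adding \<open>a\<close> times row \<open>l\<close> to row \<open>k\<close> annihilates row \<open>k\<close> of the rank one
  term, and then adding \<open>b\<close> times column \<open>l\<close> to column \<open>k\<close> annihilates its entry at \<open>(l, k)\<close>.  What
  survives is \<open>s\<close> at \<open>(l, l)\<close>.\<close>

lemma det_rank_one_edge_update:
  fixes M N :: "'a::comm_ring_1 mat"
  assumes M: "M \<in> carrier_mat n n" and N: "N \<in> carrier_mat n n"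
    and k: "k < n" and l: "l < n" and kl: "k \<noteq> l" and ab: "a * b = 1"
    and NM: "\<And>i j. i < n \<Longrightarrow> j < n \<Longrightarrow> N $$ (i, j) = M $$ (i, j) +
        s * ((if i = k then 1 else if i = l then - b else 0) *
             (if j = k then 1 else if j = l then - a else 0))"
  shows "Determinant.det N = Determinant.det M +
           s * Determinant.det (mat_delete (addcol b k l (addrow a k l M)) l l)"
proof -
  let ?X = "addcol b k l (addrow a k l M)" and ?Y = "addcol b k l (addrow a k l N)"
  have X: "?X \<in> carrier_mat n n" and Y: "?Y \<in> carrier_mat n n"
    using M N by (auto simp: mat_addcol_def)
  have "Determinant.det ?Y = Determinant.det ?X + s * Determinant.det (mat_delete ?X l l)"
  proof (rule det_add_diagonal_entry[OF X Y l])
    fix i j assume ij: "i < n" "j < n"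
    have aba: "a * (b * z) = z" "b * (a * z) = z" for z
      using ab by (simp_all add: mult.assoc[symmetric] mult.commute)
    show "?Y $$ (i, j) = ?X $$ (i, j) + (if i = l \<and> j = l then s else 0)"
      using ij k l kl M N ab
      by (auto simp: mat_addcol_def NM algebra_simps aba)
  qed
  moreover have "Determinant.det ?X = Determinant.det M"
    using det_addcol[OF l kl, of "addrow a k l M"] det_addrow[OF l kl M] M by simp
  moreover have "Determinant.det ?Y = Determinant.det N"
    using det_addcol[OF l kl, of "addrow a k l N"] det_addrow[OF l kl N] N by simp
  ultimately show ?thesis by simp
qed

section \<open>Deletion and contraction on Laplacian entries\<close>

text \<open>Indexing by vertices instead of positions in the vertex list makes the entries of a graph and
  of its contraction comparable, although the contraction has a shorter list.\<close>

definition laplacian_entry ::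
    "'a::topological_space chart set \<Rightarrow> nat \<Rightarrow> (nat \<Rightarrow> real \<Rightarrow> 'a) \<Rightarrow> (nat \<Rightarrow> real \<Rightarrow> 'a) \<Rightarrow>
     ('a, 'e) sgraph \<Rightarrow> 'a \<Rightarrow> 'a \<Rightarrow> laurent" where
  "laplacian_entry A g x y G v w =
     (if v = w then of_int (signed_degree G v) else 0) - adjacency_entry A g x y G v w"

lemma laplacian_matrix_index:
  assumes "distinct (verts G)" and "i < length (verts G)" and "j < length (verts G)"
  shows "laplacian_matrix A g x y G $$ (i, j) =
           laplacian_entry A g x y G (verts G ! i) (verts G ! j)"
  using assms by (simp add: laplacian_matrix_def laplacian_entry_def nth_eq_iff_index_eq)

lemma adjacency_entry_if:
  assumes "finite (edges G)"
  shows "adjacency_entry A g x y G v w =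
    (\<Sum>d\<in>dedges G. if pathstart (darc G d) = v \<and> pathfinish (darc G d) = w
       then of_int (esign G (fst d)) * connection A g x y (darc G d) else 0)"
  unfolding adjacency_entry_def
  by (rule sum.inter_filter) (simp add: assms dedges_def)

lemma signed_degree_if:
  assumes "finite (edges G)"
  shows "signed_degree G v =
    (\<Sum>d\<in>dedges G. if pathstart (darc G d) = v then esign G (fst d) else 0)"
  unfolding signed_degree_def
  by (rule sum.inter_filter) (simp add: assms dedges_def)

lemma sum_dedges_delete_edge:
  assumes "finite (edges G)" and "e \<in> edges G"
  shows "(\<Sum>d\<in>dedges G. f d) =
           (\<Sum>d\<in>dedges (delete_edge G e). f d) + (f (e, b) + f (e, \<not> b))"
proof -
  have "dedges G = insert (e, b) (insert (e, \<not> b) (dedges (delete_edge G e)))"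
    using assms(2) by (cases b) (auto simp: dedges_def delete_edge_def UNIV_bool)
  moreover have "(e, c) \<notin> dedges (delete_edge G e)" for c
    by (simp add: dedges_def delete_edge_def)
  moreover have "finite (dedges (delete_edge G e))"
    using assms(1) by (simp add: dedges_def delete_edge_def)
  ultimately show ?thesis by (simp add: ac_simps)
qed

text \<open>The ring identity behind the deletion formula: in the cases \<open>(v, v)\<close>, \<open>(v, w)\<close>, \<open>(w, v)\<close> and
  \<open>(w, w)\<close> the product on the right is \<open>1\<close>, \<open>- \<phi>\<close>, \<open>- \<psi>\<close> and \<open>\<psi> * \<phi> = 1\<close>.\<close>

lemma edge_entry_rank_one:
  fixes \<phi> \<psi> a :: "'r::comm_ring_1" and d \<sigma> :: int
  assumes "v \<noteq> w" and "\<psi> * \<phi> = 1"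
  shows "(if u = u' then of_int (d + ((if v = u then \<sigma> else 0) + (if w = u then \<sigma> else 0))) else 0)
      - (a + ((if v = u \<and> w = u' then of_int \<sigma> * \<phi> else 0)
            + (if w = u \<and> v = u' then of_int \<sigma> * \<psi> else 0))) =
    (if u = u' then of_int d else 0) - a + of_int \<sigma> *
      ((if u = v then 1 else if u = w then - \<psi> else 0) *
       (if u' = v then 1 else if u' = w then - \<phi> else 0))"
  using assms
  by (cases "u = v"; cases "u = w"; cases "u' = v"; cases "u' = w"; simp add: algebra_simps)

text \<open>The two directed edges arising from \<open>e\<close> are the only difference between the graphs; they
  contribute the signs to two degrees and the two connections to the off-diagonal entries.\<close>

lemma laplacian_entry_delete_edge:
  assumes fin: "finite (edges G)" and e: "e \<in> edges G"
    and v: "v = pathstart (darc G (e, b))" and w: "w = pathfinish (darc G (e, b))"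
    and vw: "v \<noteq> w"
    and unit: "connection A g x y (darc G (e, b)) * connection A g x y (darc G (e, \<not> b)) = 1"
  shows "laplacian_entry A g x y G u u' = laplacian_entry A g x y (delete_edge G e) u u' +
    of_int (esign G e) *
      ((if u = v then 1 else if u = w then - connection A g x y (darc G (e, \<not> b)) else 0) *
       (if u' = v then 1 else if u' = w then - connection A g x y (darc G (e, b)) else 0))"
proof -
  let ?D = "delete_edge G e" and ?\<sigma> = "of_int (esign G e) :: laurent"
  let ?\<phi> = "connection A g x y (darc G (e, b))" and ?\<psi> = "connection A g x y (darc G (e, \<not> b))"
  have fin': "finite (edges ?D)"
    using fin by (simp add: delete_edge_def)
  have same: "darc ?D = darc G" "esign ?D = esign G"
    by (auto simp: delete_edge_def darc_def fun_eq_iff)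
  have ends: "pathstart (darc G (e, \<not> b)) = w" "pathfinish (darc G (e, \<not> b)) = v"
    unfolding v w by (cases b; simp add: darc_def)+
  note sum_split = sum_dedges_delete_edge[OF fin e, of _ b]
  have adj: "adjacency_entry A g x y G u u' = adjacency_entry A g x y ?D u u' +
      ((if v = u \<and> w = u' then ?\<sigma> * ?\<phi> else 0) + (if w = u \<and> v = u' then ?\<sigma> * ?\<psi> else 0))"
    by (simp only: adjacency_entry_if[OF fin] adjacency_entry_if[OF fin'] same sum_split
        ends v[symmetric] w[symmetric] fst_conv)
  have deg: "signed_degree G u = signed_degree ?D u +
      ((if v = u then esign G e else 0) + (if w = u then esign G e else 0))"
    by (simp only: signed_degree_if[OF fin] signed_degree_if[OF fin'] same sum_split
        ends v[symmetric] w[symmetric] fst_conv)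
  have "?\<psi> * ?\<phi> = 1" using unit by (simp add: mult.commute)
  then show ?thesis
    unfolding laplacian_entry_def adj deg by (rule edge_entry_rank_one[OF vw])
qed

text \<open>Both directions of an edge of the contraction obey the same rule: reversal exchanges its two
  ends, and it inverts the factors picked up there.\<close>

lemma contract_edge_darc:
  assumes inside: "\<And>f. f \<in> edges G \<Longrightarrow> meets_basis_inside g x y (arc G f)"
    and e: "e \<in> edges G" and f: "f \<in> edges G"
    and v: "v = pathstart (darc G (e, b))" and w: "w = pathfinish (darc G (e, b))"
  shows "pathstart (darc (contract_edge G (e, b)) (f, c)) =
           (if pathstart (darc G (f, c)) = w then v else pathstart (darc G (f, c)))"
    and "pathfinish (darc (contract_edge G (e, b)) (f, c)) =
           (if pathfinish (darc G (f, c)) = w then v else pathfinish (darc G (f, c)))"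
    and "connection A g x y (darc (contract_edge G (e, b)) (f, c)) =
           (if pathstart (darc G (f, c)) = w then connection A g x y (darc G (e, b)) else 1)
           * connection A g x y (darc G (f, c))
           * (if pathfinish (darc G (f, c)) = w then connection A g x y (darc G (e, \<not> b)) else 1)"
proof -
  let ?r = "darc G (e, b)" and ?p = "arc G f"
  have r: "meets_basis_inside g x y ?r"
    using inside[OF e] by (simp add: darc_def meets_basis_inside_reversepath)
  note props = prolong_ends_and_exponent[OF r inside[OF f]]
  have rev_e: "path_exponent A g x y (darc G (e, \<not> b)) = - path_exponent A g x y ?r"
    using inside[OF e] by (cases b) (simp_all add: darc_def path_exponent_reversepath)
  have arc: "darc (contract_edge G (e, b)) (f, c) =
      (if c then prolong ?r ?p else reversepath (prolong ?r ?p))"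
    by (simp add: contract_edge_def darc_def)
  have pathstart: "pathstart (darc G (f, c)) = pathstart (if c then ?p else reversepath ?p)"
    by (simp add: darc_def)
  show "pathstart (darc (contract_edge G (e, b)) (f, c)) =
      (if pathstart (darc G (f, c)) = w then v else pathstart (darc G (f, c)))"
    unfolding arc v w pathstart by (cases c) (simp_all add: props)
  have pathfinish: "pathfinish (darc G (f, c)) = pathfinish (if c then ?p else reversepath ?p)"
    by (simp add: darc_def)
  show "pathfinish (darc (contract_edge G (e, b)) (f, c)) =
      (if pathfinish (darc G (f, c)) = w then v else pathfinish (darc G (f, c)))"
    unfolding arc v w pathfinish by (cases c) (simp_all add: props)
  have "path_exponent A g x y (darc (contract_edge G (e, b)) (f, c)) =
      (if pathstart (darc G (f, c)) = w then path_exponent A g x y ?r else 0)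
      + path_exponent A g x y (darc G (f, c))
      + (if pathfinish (darc G (f, c)) = w then path_exponent A g x y (darc G (e, \<not> b)) else 0)"
  proof (cases c)
    case True
    then have "darc G (f, c) = ?p" by (simp add: darc_def)
    then show ?thesis unfolding arc rev_e w using True by (simp add: props)
  next
    case False
    then have "darc G (f, c) = reversepath ?p" by (simp add: darc_def)
    then show ?thesis unfolding arc rev_e w using False
      by (simp add: props path_exponent_reversepath inside[OF f])
  qed
  then show "connection A g x y (darc (contract_edge G (e, b)) (f, c)) =
      (if pathstart (darc G (f, c)) = w then connection A g x y (darc G (e, b)) else 1)
      * connection A g x y (darc G (f, c))
      * (if pathfinish (darc G (f, c)) = w then connection A g x y (darc G (e, \<not> b)) else 1)"
    by (simp add: connection_def mult_single)
qed

text \<open>The contribution of one directed edge from \<open>s\<close> to \<open>t\<close> with connection \<open>c\<close> and sign \<open>\<sigma>\<close> to the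
  entry \<open>(u, u')\<close> of the contraction.  At most one of the four summands on the right is nonzero,
  according to which of the ends are at \<open>w\<close>.\<close>

lemma merged_edge_contribution:
  fixes \<sigma> c \<phi> \<psi> :: "'r::comm_ring_1"
  assumes "v \<noteq> w" and "u \<noteq> w" and "u' \<noteq> w"
  shows "(if (if s = w then v else s) = u \<and> (if t = w then v else t) = u'
      then \<sigma> * ((if s = w then \<phi> else 1) * c * (if t = w then \<psi> else 1)) else 0) =
    (if s = u \<and> t = u' then \<sigma> * c else 0)
    + (if u = v then \<phi> * (if s = w \<and> t = u' then \<sigma> * c else 0) else 0)
    + (if u' = v then \<psi> * ((if s = u \<and> t = w then \<sigma> * c else 0)
        + (if u = v then \<phi> * (if s = w \<and> t = w then \<sigma> * c else 0) else 0)) else 0)"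
  using assms by auto

text \<open>The merged adjacency entries and degrees combine to the merged Laplacian entries because the
  degree of \<open>w\<close> is multiplied by \<open>\<phi> * \<psi> = 1\<close>.\<close>

lemma merged_laplacian_entry:
  fixes \<phi> \<psi> :: "'r::comm_ring_1" and a :: "'v \<Rightarrow> 'v \<Rightarrow> 'r" and d :: "'v \<Rightarrow> int"
  assumes "v \<noteq> w" and "u \<noteq> w" and "u' \<noteq> w" and unit: "\<phi> * \<psi> = 1"
  shows "(if u = u' then of_int (d u + (if u = v then d w else 0)) else 0)
      - (a u u' + (if u = v then \<phi> * a w u' else 0)
        + (if u' = v then \<psi> * (a u w + (if u = v then \<phi> * a w w else 0)) else 0)) =
    ((if u = u' then of_int (d u) else 0) - a u u')
    + (if u = v then \<phi> * ((if w = u' then of_int (d w) else 0) - a w u') else 0)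
    + (if u' = v then \<psi> * (((if u = w then of_int (d u) else 0) - a u w)
        + (if u = v then \<phi> * ((if w = w then of_int (d w) else 0) - a w w) else 0)) else 0)"
proof -
  have cancel: "\<psi> * (\<phi> * z) = z" "\<phi> * (\<psi> * z) = z" for z
    using unit by (simp_all add: mult.assoc[symmetric] mult.commute)
  show ?thesis using assms(1-3) by (auto simp: algebra_simps cancel)
qed

text \<open>The right-hand side is the entry obtained from the deletion by adding \<open>\<phi>\<close> times row \<open>w\<close> to row
  \<open>v\<close> and then \<open>\<psi>\<close> times column \<open>w\<close> to column \<open>v\<close>.\<close>

lemma laplacian_entry_contract_edge:
  assumes fin: "finite (edges G)"
    and inside: "\<And>f. f \<in> edges G \<Longrightarrow> meets_basis_inside g x y (arc G f)"
    and e: "e \<in> edges G"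
    and v: "v = pathstart (darc G (e, b))" and w: "w = pathfinish (darc G (e, b))"
    and vw: "v \<noteq> w" and u: "u \<noteq> w" "u' \<noteq> w"
    and \<phi>: "\<phi> = connection A g x y (darc G (e, b))"
    and \<psi>: "\<psi> = connection A g x y (darc G (e, \<not> b))"
    and unit: "\<phi> * \<psi> = 1"
    and L: "L = laplacian_entry A g x y (delete_edge G e)"
  shows "laplacian_entry A g x y (contract_edge G (e, b)) u u' =
      L u u' + (if u = v then \<phi> * L w u' else 0)
      + (if u' = v then \<psi> * (L u w + (if u = v then \<phi> * L w w else 0)) else 0)"
proof -
  let ?C = "contract_edge G (e, b)" and ?D = "delete_edge G e"
  let ?a = "adjacency_entry A g x y ?D"
  have fin': "finite (edges ?C)" "finite (edges ?D)"
    using fin by (auto simp: contract_edge_def delete_edge_def)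
  have same: "dedges ?C = dedges ?D" "darc ?D = darc G" "esign ?D = esign G" "esign ?C = esign G"
    by (auto simp: contract_edge_def delete_edge_def dedges_def darc_def fun_eq_iff)
  have dG: "fst d \<in> edges G" if "d \<in> dedges ?D" for d
    using that by (auto simp: dedges_def delete_edge_def)
  have darc: "pathstart (darc ?C d) = (if pathstart (darc G d) = w then v else pathstart (darc G d))"
    "pathfinish (darc ?C d) = (if pathfinish (darc G d) = w then v else pathfinish (darc G d))"
    "connection A g x y (darc ?C d) = (if pathstart (darc G d) = w then \<phi> else 1)
      * connection A g x y (darc G d) * (if pathfinish (darc G d) = w then \<psi> else 1)"
    if "d \<in> dedges ?D" for d
    using contract_edge_darc[OF inside e dG[OF that] v w, where c = "snd d"]
    by (simp_all only: prod.collapse \<phi> \<psi>)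
  have adj: "adjacency_entry A g x y ?C u u' =
      ?a u u' + (if u = v then \<phi> * ?a w u' else 0)
      + (if u' = v then \<psi> * (?a u w + (if u = v then \<phi> * ?a w w else 0)) else 0)"
  proof -
    define summand where "summand = (\<lambda>d s t. if pathstart (darc G d) = s \<and> pathfinish (darc G d) = t
      then of_int (esign G (fst d)) * connection A g x y (darc G d) else 0)"
    have a: "?a s t = (\<Sum>d\<in>dedges ?D. summand d s t)" for s t
      unfolding adjacency_entry_if[OF fin'(2)] summand_def same by simp
    have "adjacency_entry A g x y ?C u u' =
        (\<Sum>d\<in>dedges ?D. summand d u u' + (if u = v then \<phi> * summand d w u' else 0)
          + (if u' = v then \<psi> * (summand d u w + (if u = v then \<phi> * summand d w w else 0)) else 0))"
      unfolding adjacency_entry_if[OF fin'(1)] same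
    proof (rule sum.cong[OF refl])
      fix d assume d: "d \<in> dedges ?D"
      show "(if pathstart (darc ?C d) = u \<and> pathfinish (darc ?C d) = u'
          then of_int (esign G (fst d)) * connection A g x y (darc ?C d) else 0) =
        summand d u u' + (if u = v then \<phi> * summand d w u' else 0)
          + (if u' = v then \<psi> * (summand d u w + (if u = v then \<phi> * summand d w w else 0)) else 0)"
        unfolding darc[OF d] summand_def
        by (rule merged_edge_contribution[OF vw u])
    qed
    also have "\<dots> = ?a u u' + (if u = v then \<phi> * ?a w u' else 0)
      + (if u' = v then \<psi> * (?a u w + (if u = v then \<phi> * ?a w w else 0)) else 0)"
      unfolding a
      by (cases "u = v"; cases "u' = v") (simp_all add: sum.distrib sum_distrib_left distrib_left)
    finally show ?thesis .
  qed
  have deg: "signed_degree ?C u =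
      signed_degree ?D u + (if u = v then signed_degree ?D w else 0)"
  proof -
    have "signed_degree ?C u = (\<Sum>d\<in>dedges ?D.
        (if pathstart (darc G d) = u then esign G (fst d) else 0)
        + (if u = v then if pathstart (darc G d) = w then esign G (fst d) else 0 else 0))"
      unfolding signed_degree_if[OF fin'(1)] same
      by (rule sum.cong[OF refl]) (use vw u in \<open>auto simp: darc\<close>)
    also have "\<dots> = signed_degree ?D u + (if u = v then signed_degree ?D w else 0)"
      unfolding signed_degree_if[OF fin'(2)] same
      by (cases "u = v") (simp_all add: sum.distrib)
    finally show ?thesis .
  qed
  show ?thesis
    unfolding L laplacian_entry_def adj deg by (rule merged_laplacian_entry[OF vw u unit])
qed

text \<open>Removing a vertex from the list shifts the indices in the same way as deleting a row and a
  column of a matrix.\<close>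

lemma nth_remove1_nth:
  assumes "distinct xs" and "l < length xs" and "i < length xs - 1"
  shows "remove1 (xs ! l) xs ! i = xs ! (if i < l then i else Suc i)"
proof -
  have xs: "xs = take l xs @ xs ! l # drop (Suc l) xs"
    using assms(2) by (rule id_take_nth_drop)
  have "xs ! l \<notin> set (take l xs)"
    using assms(1,2) by (auto simp: in_set_conv_nth nth_eq_iff_index_eq)
  then have "remove1 (xs ! l) xs = take l xs @ drop (Suc l) xs"
    using remove1_append[of "xs ! l" "take l xs" "xs ! l # drop (Suc l) xs"] xs by simp
  then show ?thesis
    using assms(2,3) by (simp add: nth_append)
qed

theorem proposition2p5:
  fixes S :: "'a::topological_space set"
    and A :: "'a chart set"
    and g :: nat
    and x y :: "nat \<Rightarrow> real \<Rightarrow> 'a"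
    and G :: "('a, 'e) sgraph"
    and e :: 'e
    and b :: bool
  assumes "closed_oriented_surface S A g"
    and "symplectic_basis S A g x y"
    and "signed_graph_in S G"
    and "curves_transverse_to_graph A g x y G"
    and "e \<in> edges G"
    and "\<not> is_loop G e"
  shows "laplacian_polynomial A g x y G =
           laplacian_polynomial A g x y (delete_edge G e)
           + of_int (esign G e) * laplacian_polynomial A g x y (contract_edge G (e, b))"
proof -
  let ?D = "delete_edge G e" and ?C = "contract_edge G (e, b)"
  let ?vs = "verts G" and ?n = "length (verts G)"
  define v w where "v = pathstart (darc G (e, b))" and "w = pathfinish (darc G (e, b))"
  define \<phi> \<psi> where "\<phi> = connection A g x y (darc G (e, b))"
    and "\<psi> = connection A g x y (darc G (e, \<not> b))"
  have dist: "distinct ?vs" and fin: "finite (edges G)"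
    and ends: "\<And>f. f \<in> edges G \<Longrightarrow> arc G f 0 \<in> set ?vs \<and> arc G f 1 \<in> set ?vs"
    using assms(3) by (auto simp: signed_graph_in_def pathstart_def pathfinish_def)
  have inside: "meets_basis_inside g x y (arc G f)" if "f \<in> edges G" for f
    using assms(4) ends[OF that] that
    unfolding curves_transverse_to_graph_def meets_basis_inside_def meets_inside_def transverse_def
    by blast
  have vw: "v \<noteq> w"
    using assms(6) by (cases b) (auto simp: v_def w_def darc_def is_loop_def)
  have "v \<in> set ?vs" "w \<in> set ?vs"
    using ends[OF assms(5)]
    by (auto simp: v_def w_def darc_def pathstart_def pathfinish_def reversepath_def)
  then obtain k l where k: "k < ?n" "?vs ! k = v" and l: "l < ?n" "?vs ! l = w"
    by (auto simp: in_set_conv_nth)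
  have kl: "k \<noteq> l" using k l vw by auto
  have unit: "\<phi> * \<psi> = 1"
    using connection_reversepath_inverse[OF inside[OF assms(5)], of A]
    by (cases b) (simp_all add: \<phi>_def \<psi>_def darc_def mult.commute)
  have verts: "verts ?D = ?vs" "verts ?C = remove1 w ?vs"
    by (simp_all add: delete_edge_def contract_edge_def w_def)
  have dist': "distinct (verts ?D)" "distinct (verts ?C)" using dist by (simp_all add: verts)
  have len: "length (verts ?C) = ?n - 1"
    using l by (auto simp: verts length_remove1)
  let ?M = "laplacian_matrix A g x y ?D" and ?N = "laplacian_matrix A g x y G"
  have index: "?vs ! i = ?vs ! j \<longleftrightarrow> i = j" if "i < ?n" "j < ?n" for i j
    using dist that by (simp add: nth_eq_iff_index_eq)
  have M: "?M \<in> carrier_mat ?n ?n" and N: "?N \<in> carrier_mat ?n ?n"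
    by (simp_all add: laplacian_matrix_def verts)
  have M_entry: "?M $$ (i, j) = laplacian_entry A g x y ?D (?vs ! i) (?vs ! j)"
    if "i < ?n" "j < ?n" for i j
    using laplacian_matrix_index[OF dist'(1), of i j] that by (simp add: verts)
  have "Determinant.det ?N = Determinant.det ?M + of_int (esign G e) *
      Determinant.det (mat_delete (addcol \<psi> k l (addrow \<phi> k l ?M)) l l)"
  proof (rule det_rank_one_edge_update[OF M N k(1) l(1) kl unit])
    fix i j assume ij: "i < ?n" "j < ?n"
    have eqs: "?vs ! i = v \<longleftrightarrow> i = k" "?vs ! i = w \<longleftrightarrow> i = l"
      "?vs ! j = v \<longleftrightarrow> j = k" "?vs ! j = w \<longleftrightarrow> j = l"
      using index ij k l by auto
    show "?N $$ (i, j) = ?M $$ (i, j) + of_int (esign G e) *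
        ((if i = k then 1 else if i = l then - \<psi> else 0) *
         (if j = k then 1 else if j = l then - \<phi> else 0))"
      unfolding M_entry[OF ij] laplacian_matrix_index[OF dist ij]
        laplacian_entry_delete_edge[OF fin assms(5) v_def w_def vw unit[unfolded \<phi>_def \<psi>_def]]
        eqs \<phi>_def[symmetric] \<psi>_def[symmetric] ..
  qed
  also have "mat_delete (addcol \<psi> k l (addrow \<phi> k l ?M)) l l = laplacian_matrix A g x y ?C"
  proof (rule eq_matI)
    show "dim_row (mat_delete (addcol \<psi> k l (addrow \<phi> k l ?M)) l l) =
        dim_row (laplacian_matrix A g x y ?C)"
      "dim_col (mat_delete (addcol \<psi> k l (addrow \<phi> k l ?M)) l l) =
        dim_col (laplacian_matrix A g x y ?C)"
      using M len by (simp_all add: laplacian_matrix_def mat_addcol_def verts)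
  next
    fix i j assume "i < dim_row (laplacian_matrix A g x y ?C)"
      and "j < dim_col (laplacian_matrix A g x y ?C)"
    then have ij: "i < ?n - 1" "j < ?n - 1" by (simp_all add: laplacian_matrix_def len)
    define i' j' where "i' = (if i < l then i else Suc i)" and "j' = (if j < l then j else Suc j)"
    have ij': "i' < ?n" "j' < ?n" "i' \<noteq> l" "j' \<noteq> l" using ij by (auto simp: i'_def j'_def)
    have vert: "verts ?C ! i = ?vs ! i'" "verts ?C ! j = ?vs ! j'"
      using nth_remove1_nth[OF dist l(1)] ij by (auto simp: verts l i'_def j'_def)
    have eqs: "?vs ! i' = v \<longleftrightarrow> k = i'" "?vs ! j' = v \<longleftrightarrow> k = j'"
      and neq: "?vs ! i' \<noteq> w" "?vs ! j' \<noteq> w"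
      using index ij' k l by auto
    have "mat_delete (addcol \<psi> k l (addrow \<phi> k l ?M)) l l $$ (i, j) =
        addcol \<psi> k l (addrow \<phi> k l ?M) $$ (i', j')"
      using ij M by (simp add: mat_delete_def mat_addcol_def i'_def j'_def)
    also have "\<dots> = ?M $$ (i', j') + (if k = i' then \<phi> * ?M $$ (l, j') else 0)
        + (if k = j' then \<psi> * (?M $$ (i', l) + (if k = i' then \<phi> * ?M $$ (l, l) else 0)) else 0)"
      using ij' l M by (auto simp: mat_addcol_def algebra_simps)
    also have "\<dots> = laplacian_entry A g x y ?C (?vs ! i') (?vs ! j')"
      using laplacian_entry_contract_edge[OF fin inside assms(5) v_def w_def vw neq
          \<phi>_def \<psi>_def unit refl] ij' l
      by (simp add: M_entry eqs)
    also have "\<dots> = laplacian_matrix A g x y ?C $$ (i, j)"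
      using laplacian_matrix_index[OF dist'(2), of i j] ij by (simp add: len vert)
    finally show "mat_delete (addcol \<psi> k l (addrow \<phi> k l ?M)) l l $$ (i, j) =
        laplacian_matrix A g x y ?C $$ (i, j)" .
  qed
  finally show ?thesis
    by (simp add: laplacian_polynomial_def)
qed

end
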